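(* Let $n\ge1$, let $0=b_0<b_1<\cdots<b_n<b_{n+1}=1$, let $a,r\in L^\infty(I)$, $I=(0,1)$, with $a\ge a_0>0$ and $r\ge r_0\ge0$ a.e. on $I$ for constants $a_0,r_0$. Then, with $T_1=Q^T$, $T_3=Q$ and $Q=G\,\mathbf D(\mathbf h)^{-1}G$, the sum of the stiffness and mass matrices has the factorization $$A_a(\mathbf b)+M_r(\mathbf b)=T_1^{-1}\,T_4\,T_3^{-1}=Q^{-T}\left(T_{A_a}+T_{M_r}\right)Q^{-1},$$ where $T_4=T_{A_a}+T_{M_r}$ is the tri-diagonal matrix defined by $$T_{A_a}=G^T\mathbf D(\mathbf h)^{-2}\mathbf D_a(\mathbf s^0)G,$$ $$T_{M_r}=(I-G^T)\mathbf D_{00}(r)(I-G)+(I-G^T)\mathbf D_{01}(r)G+G^T\mathbf D_{10}(r)(I-G)+G^T\mathbf D_{11}(r)G .$$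
   Context: $\sigma(t)=\max\{0,t\}$; $H$ is the Heaviside function ($H(t)=1$ for $t>0$, $H(0)=\tfrac12$, $H(t)=0$ for $t<0$); $\mathbf b=(b_1,\dots,b_n)^T$; $h_i=b_{i+1}-b_i$, $i=0,\dots,n$. For $i,j=1,\dots,n+1$ the mass matrix $M_r(\mathbf b)$ has entries $\int_0^1 r(x)\sigma(x-b_{i-1})\sigma(x-b_{j-1})\,dx$, and the stiffness matrix $A_a(\mathbf b)$ has entries $\int_0^1 a(x)H(x-b_{i-1})H(x-b_{j-1})\,dx$. All the following matrices have size $(n+1)\times(n+1)$: $I$ is the identity (in matrix expressions); $G$ is lower bidiagonal with $1$ on the diagonal, $-1$ on the first subdiagonal, $0$ elsewhere; $\mathbf D(\mathbf h)=\mathrm{diag}(h_0,\dots,h_n)$; for a weight $\omega\in\{a,r\}$ and $k=0,1,2$, $\mathbf D_\omega(\mathbf s^k)=\mathrm{diag}(s^k_0(\omega),\dots,s^k_n(\omega))$ with $s^k_i(\omega)=\int_{b_i}^{b_{i+1}}\omega(x)(x-b_i)^k\,dx$; $\mathbf D_{00}(r)=\mathbf D_r(\mathbf s^0)$, $\mathbf D_{01}(r)=\mathbf D_{10}(r)=\mathbf D(\mathbf h)^{-1}\mathbf D_r(\mathbf s^1)$, $\mathbf D_{11}(r)=\mathbf D(\mathbf h)^{-2}\mathbf D_r(\mathbf s^2)$. $Q^{-T}$ denotes $(Q^{-1})^T$. *)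

theory Defs
  imports "HOL-Analysis.Analysis" "Jordan_Normal_Form.Gauss_Jordan_Elimination"
begin

text \<open>Matrices carry their size explicitly; rows and columns are numbered \<open>0, \<dots>, n\<close>,
  so the row written \<open>i\<close> in the usual \<open>1, \<dots>, n + 1\<close> numbering is row \<open>i - 1\<close> here and
  belongs to the breakpoint \<open>b (i - 1)\<close>. Only \<open>b 0, \<dots>, b (n + 1)\<close> are used.\<close>

abbreviation unit_interval :: "real set" where
  "unit_interval \<equiv> {0<..<1}"

definition Linfty :: "real set \<Rightarrow> (real \<Rightarrow> real) set" where
  "Linfty S = {f. f \<in> borel_measurable (lebesgue_on S) \<and>
                  (\<exists>C. AE x in lebesgue_on S. \<bar>f x\<bar> \<le> C)}"

definition relu :: "real \<Rightarrow> real" where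
  "relu t = max 0 t"

definition heaviside :: "real \<Rightarrow> real" where
  "heaviside t = (if t > 0 then 1 else if t = 0 then 1/2 else 0)"

definition mass_matrix :: "nat \<Rightarrow> (real \<Rightarrow> real) \<Rightarrow> (nat \<Rightarrow> real) \<Rightarrow> real mat" where
  "mass_matrix n r b = Matrix.mat (n + 1) (n + 1)
     (\<lambda>(i, j). LINT x|lebesgue_on unit_interval. r x * relu (x - b i) * relu (x - b j))"

definition stiffness_matrix :: "nat \<Rightarrow> (real \<Rightarrow> real) \<Rightarrow> (nat \<Rightarrow> real) \<Rightarrow> real mat" where
  "stiffness_matrix n a b = Matrix.mat (n + 1) (n + 1)
     (\<lambda>(i, j). LINT x|lebesgue_on unit_interval.
        a x * heaviside (x - b i) * heaviside (x - b j))"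

text \<open>For a singular matrix the value is unspecified.\<close>
definition minv :: "real mat \<Rightarrow> real mat" where
  "minv A = the (mat_inverse A)"

definition tridiagonal_mat :: "'a::zero mat \<Rightarrow> bool" where
  "tridiagonal_mat A \<longleftrightarrow> square_mat A \<and>
     (\<forall>i<dim_row A. \<forall>j<dim_col A. \<bar>int i - int j\<bar> > 1 \<longrightarrow> A $$ (i, j) = 0)"

definition G_mat :: "nat \<Rightarrow> real mat" where
  "G_mat n = Matrix.mat (n + 1) (n + 1)
     (\<lambda>(i, j). if i = j then 1 else if i = j + 1 then - 1 else 0)"

definition mesh_size :: "(nat \<Rightarrow> real) \<Rightarrow> nat \<Rightarrow> real" where
  "mesh_size b i = b (i + 1) - b i"

definition Dh :: "nat \<Rightarrow> (nat \<Rightarrow> real) \<Rightarrow> real mat" where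
  "Dh n b = mat_diag (n + 1) (mesh_size b)"

definition local_moment :: "(real \<Rightarrow> real) \<Rightarrow> (nat \<Rightarrow> real) \<Rightarrow> nat \<Rightarrow> nat \<Rightarrow> real" where
  "local_moment w b k i = (LINT x|lebesgue_on {b i<..<b (i + 1)}. w x * (x - b i) ^ k)"

definition Ds :: "nat \<Rightarrow> (real \<Rightarrow> real) \<Rightarrow> (nat \<Rightarrow> real) \<Rightarrow> nat \<Rightarrow> real mat" where
  "Ds n w b k = mat_diag (n + 1) (local_moment w b k)"

definition D00 :: "nat \<Rightarrow> (real \<Rightarrow> real) \<Rightarrow> (nat \<Rightarrow> real) \<Rightarrow> real mat" where
  "D00 n r b = Ds n r b 0"

definition D01 :: "nat \<Rightarrow> (real \<Rightarrow> real) \<Rightarrow> (nat \<Rightarrow> real) \<Rightarrow> real mat" where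
  "D01 n r b = minv (Dh n b) * Ds n r b 1"

definition D10 :: "nat \<Rightarrow> (real \<Rightarrow> real) \<Rightarrow> (nat \<Rightarrow> real) \<Rightarrow> real mat" where
  "D10 n r b = minv (Dh n b) * Ds n r b 1"

definition D11 :: "nat \<Rightarrow> (real \<Rightarrow> real) \<Rightarrow> (nat \<Rightarrow> real) \<Rightarrow> real mat" where
  "D11 n r b = minv (Dh n b) ^\<^sub>m 2 * Ds n r b 2"

definition T_stiff :: "nat \<Rightarrow> (real \<Rightarrow> real) \<Rightarrow> (nat \<Rightarrow> real) \<Rightarrow> real mat" where
  "T_stiff n a b =
     transpose_mat (G_mat n) * minv (Dh n b) ^\<^sub>m 2 * Ds n a b 0 * G_mat n"

definition T_mass :: "nat \<Rightarrow> (real \<Rightarrow> real) \<Rightarrow> (nat \<Rightarrow> real) \<Rightarrow> real mat" where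
  "T_mass n r b =
     (let I = 1\<^sub>m (n + 1); G = G_mat n; Gt = transpose_mat (G_mat n) in
        (I - Gt) * D00 n r b * (I - G) + (I - Gt) * D01 n r b * G
        + Gt * D10 n r b * (I - G) + Gt * D11 n r b * G)"

definition Q_mat :: "nat \<Rightarrow> (nat \<Rightarrow> real) \<Rightarrow> real mat" where
  "Q_mat n b = G_mat n * minv (Dh n b) * G_mat n"

end

(* G turns the ReLU functions sigma(x - b_i) and their derivatives into differences of
   neighbours, so G^(-1) =: L is the lower triangular matrix of ones and Q^(-1) = L D(h) L =: R.
   On the k-th mesh element, with y = x - b_k,
     H(x - b_i) = L_(k,i)   and   sigma(x - b_i) = B_(k,i) + y L_(k,i),
   where B_(k,i) = b_k - b_i for i <= k and 0 otherwise. Summing over the elements gives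
     A_a = L^T D_a(s^0) L,
     M_r = B^T D_r(s^0) B + B^T D_r(s^1) L + L^T D_r(s^1) B + L^T D_r(s^2) L,
   and since G R = D(h) L and (I - G) R = (L - I) D(h) L = B, these are exactly
   R^T T_(A_a) R and R^T T_(M_r) R. *)

theory Submission
  imports Defs "Jordan_Normal_Form.Determinant"
begin

section \<open>Matrix inverses, congruences and tridiagonal products\<close>

lemma minv_eq:
  assumes "A \<in> carrier_mat N N" "B \<in> carrier_mat N N" "A * B = 1\<^sub>m N" "B * A = 1\<^sub>m N"
  shows "minv A = B"
proof (cases "mat_inverse A")
  case None
  \<comment> \<open>\<open>mat_inverse\<close> returns \<open>None\<close> only for a non-unit of
    the matrix ring, while \<open>B\<close> exhibits \<open>A\<close> as a unit. The ring carries a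
    dummy argument, here \<open>b\<close>, later set to \<open>()\<close>.\<close>
  have "A \<in> Units (ring_mat TYPE(real) N b)" for b :: unit
    unfolding Units_def ring_mat_simps using assms by blast
  then show ?thesis using mat_inverse(1)[OF assms(1) None, of "()"] by contradiction
next
  case (Some C)
  then have C: "C * A = 1\<^sub>m N" "C \<in> carrier_mat N N"
    using mat_inverse(2)[OF assms(1) Some] by auto
  have "C = C * (A * B)" using assms(3) C(2) by simp
  also have "\<dots> = (C * A) * B" by (rule assoc_mult_mat[symmetric, OF C(2) assms(1,2)])
  also have "\<dots> = B" using assms(2) C(1) by simp
  finally show ?thesis using Some by (simp add: minv_def)
qed

lemma invertible_matI:
  fixes A B :: "real mat"
  assumes "A \<in> carrier_mat N N" "B \<in> carrier_mat N N" "A * B = 1\<^sub>m N" "B * A = 1\<^sub>m N"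
  shows "invertible_mat A"
  unfolding invertible_mat_def inverts_mat_def using assms
  by (intro conjI exI[of _ B]) simp_all

lemma index_mult_mat_sum:
  fixes A B :: "real mat"
  assumes "A \<in> carrier_mat N N" "B \<in> carrier_mat N N" "i < N" "j < N"
  shows "(A * B) $$ (i, j) = (\<Sum>k<N. A $$ (i, k) * B $$ (k, j))"
proof -
  have "(A * B) $$ (i, j) = (\<Sum>k = 0..<N. Matrix.row A i $ k * col B j $ k)"
    using assms by (simp add: scalar_prod_def)
  also have "\<dots> = (\<Sum>k<N. A $$ (i, k) * B $$ (k, j))"
    using assms by (intro sum.cong) auto
  finally show ?thesis .
qed

lemma mat_diag_eq_one: "(\<And>i. i < N \<Longrightarrow> d i = 1) \<Longrightarrow> mat_diag N d = 1\<^sub>m N"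
  by (rule eq_matI) (auto simp: mat_diag_def)

lemma minv_mat_diag:
  assumes "\<And>i. i < N \<Longrightarrow> d i \<noteq> 0"
  shows "minv (mat_diag N d) = mat_diag N (\<lambda>i. inverse (d i))"
proof (rule minv_eq)
  show "mat_diag N d * mat_diag N (\<lambda>i. inverse (d i)) = 1\<^sub>m N"
    "mat_diag N (\<lambda>i. inverse (d i)) * mat_diag N d = 1\<^sub>m N"
    using assms by (simp_all add: mat_diag_eq_one)
qed auto

text \<open>This is the shape of a bilinear form assembled over a mesh: \<open>k\<close> runs over
  the elements, \<open>d k\<close> is a weight moment, and rows \<open>k\<close> of \<open>X\<close>
  and \<open>Y\<close> hold the local data of the basis functions.\<close>

lemma index_transpose_diag_mult:
  fixes X Y :: "real mat"
  assumes "X \<in> carrier_mat N N" "Y \<in> carrier_mat N N" "i < N" "j < N"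
  shows "(transpose_mat X * mat_diag N d * Y) $$ (i, j) =
    (\<Sum>k<N. X $$ (k, i) * d k * Y $$ (k, j))"
proof -
  have "(transpose_mat X * mat_diag N d * Y) $$ (i, j) =
      (\<Sum>k<N. (transpose_mat X * mat_diag N d) $$ (i, k) * Y $$ (k, j))"
    using assms by (intro index_mult_mat_sum) (auto intro: mult_carrier_mat)
  also have "\<dots> = (\<Sum>k<N. X $$ (k, i) * d k * Y $$ (k, j))"
    using assms by (subst mat_diag_mult_right[where nr = N]) (auto intro!: sum.cong)
  finally show ?thesis .
qed

text \<open>Lets \<open>R\<close> be absorbed by the outer factors, so that only the products
  \<open>X * R\<close> and \<open>Y * R\<close> have to be computed.\<close>

lemma congruence_transpose_diag_mult:
  fixes X Y R :: "real mat"
  assumes "X \<in> carrier_mat N N" "Y \<in> carrier_mat N N" "R \<in> carrier_mat N N"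
    and "E \<in> carrier_mat N N"
  shows "transpose_mat R * (transpose_mat X * E * Y) * R =
    transpose_mat (X * R) * E * (Y * R)"
  using assms by (simp add: transpose_mult[of _ N N] assoc_mult_mat[of _ N N _ N _ N])

lemma congruence_add:
  fixes A B R :: "real mat"
  assumes "A \<in> carrier_mat N N" "B \<in> carrier_mat N N" "R \<in> carrier_mat N N"
  shows "transpose_mat R * (A + B) * R = transpose_mat R * A * R + transpose_mat R * B * R"
  using assms
  by (simp add: mult_add_distrib_mat[of _ N N _ N] add_mult_distrib_mat[of _ N N _ _ N])

text \<open>Both outer factors are lower bidiagonal, so the summand for \<open>k\<close> can be
  nonzero only if \<open>i\<close> and \<open>j\<close> both lie in {k - 1, k}, which forces them to
  differ by at most 1.\<close>

lemma tridiagonal_mat_transpose_diag_mult: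
  fixes X Y :: "real mat"
  assumes "X \<in> carrier_mat N N" "Y \<in> carrier_mat N N"
    and "\<And>k i. k < N \<Longrightarrow> i < N \<Longrightarrow> k \<noteq> i \<Longrightarrow> k \<noteq> Suc i \<Longrightarrow> X $$ (k, i) = 0"
    and "\<And>k i. k < N \<Longrightarrow> i < N \<Longrightarrow> k \<noteq> i \<Longrightarrow> k \<noteq> Suc i \<Longrightarrow> Y $$ (k, i) = 0"
  shows "tridiagonal_mat (transpose_mat X * mat_diag N d * Y)"
  unfolding tridiagonal_mat_def
proof (intro conjI allI impI)
  show "square_mat (transpose_mat X * mat_diag N d * Y)" using assms(1,2) by simp
next
  fix i j
  assume "i < dim_row (transpose_mat X * mat_diag N d * Y)"
    "j < dim_col (transpose_mat X * mat_diag N d * Y)" and far: "1 < \<bar>int i - int j\<bar>"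
  then have ij: "i < N" "j < N" using assms(1,2) by auto
  have "X $$ (k, i) * d k * Y $$ (k, j) = 0" if "k < N" for k
  proof (cases "k = i \<or> k = Suc i")
    case True
    then have "k \<noteq> j" "k \<noteq> Suc j" using far by auto
    then show ?thesis using assms(4) that ij by simp
  qed (use assms(3) that ij in simp)
  then show "(transpose_mat X * mat_diag N d * Y) $$ (i, j) = 0"
    unfolding index_transpose_diag_mult[OF assms(1,2) ij] by (intro sum.neutral) auto
qed

lemma tridiagonal_mat_add:
  fixes A B :: "real mat"
  assumes "tridiagonal_mat A" "tridiagonal_mat B" "A \<in> carrier_mat N N" "B \<in> carrier_mat N N"
  shows "tridiagonal_mat (A + B)"
  using assms unfolding tridiagonal_mat_def by auto

section \<open>Matrices of local basis data and their relation to G\<close>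

definition L_mat :: "nat \<Rightarrow> real mat" where
  "L_mat n = Matrix.mat (Suc n) (Suc n) (\<lambda>(k, i). if i \<le> k then 1 else 0)"

text \<open>For increasing breakpoints, column \<open>i\<close> lists the values of sigma(x - b_i)
  at the left endpoints of the elements.\<close>

definition offset_mat :: "nat \<Rightarrow> (nat \<Rightarrow> real) \<Rightarrow> real mat" where
  "offset_mat n b = Matrix.mat (Suc n) (Suc n) (\<lambda>(k, i). if i \<le> k then b k - b i else 0)"

lemma G_mat_carrier [simp]: "G_mat n \<in> carrier_mat (Suc n) (Suc n)"
  and L_mat_carrier [simp]: "L_mat n \<in> carrier_mat (Suc n) (Suc n)"
  and offset_mat_carrier [simp]: "offset_mat n b \<in> carrier_mat (Suc n) (Suc n)"
  and Dh_carrier [simp]: "Dh n b \<in> carrier_mat (Suc n) (Suc n)"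
  by (simp_all add: G_mat_def L_mat_def offset_mat_def Dh_def)

lemma G_mat_mult_L_mat: "G_mat n * L_mat n = 1\<^sub>m (Suc n)"
proof (rule eq_matI)
  fix i j assume "i < dim_row (1\<^sub>m (Suc n) :: real mat)" "j < dim_col (1\<^sub>m (Suc n) :: real mat)"
  then have ij: "i < Suc n" "j < Suc n" by auto
  have "(G_mat n * L_mat n) $$ (i, j) =
      (\<Sum>k<Suc n. (if i = k then 1 else if i = k + 1 then - 1 else 0) * (if j \<le> k then 1 else 0))"
    using ij by (subst index_mult_mat_sum) (auto simp: G_mat_def L_mat_def intro!: sum.cong simp del: sum.lessThan_Suc)
  \<comment> \<open>Row \<open>i\<close> of \<open>G_mat n\<close> has entries only in columns
    \<open>i\<close> and \<open>i - 1\<close>. On naturals \<open>i - 1\<close> is 0 when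
    \<open>i = 0\<close>, so the guard \<open>0 < i\<close> removes the spurious second
    term.\<close>
  also have "\<dots> = (\<Sum>k<Suc n. (if k = i then if j \<le> i then 1 else 0 else 0)
      + (if k = i - 1 then if 0 < i \<and> j \<le> i - 1 then - 1 else 0 else 0))"
    by (intro sum.cong) auto
  also have "\<dots> = (1\<^sub>m (Suc n) :: real mat) $$ (i, j)"
    using ij by (auto simp: sum.distrib simp del: sum.lessThan_Suc)
  finally show "(G_mat n * L_mat n) $$ (i, j) = (1\<^sub>m (Suc n) :: real mat) $$ (i, j)" .
qed (auto simp: G_mat_def L_mat_def)

text \<open>The strictly lower triangular \<open>L - I\<close> restricts the sum to i \<le> m < k,
  where the mesh sizes telescope to \<open>b k - b i\<close>.\<close>

lemma L_mat_minus_one_mult_Dh_mult_L_mat: "(L_mat n - 1\<^sub>m (Suc n)) * (Dh n b * L_mat n) = offset_mat n b"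
proof (rule eq_matI)
  fix k i assume "k < dim_row (offset_mat n b)" "i < dim_col (offset_mat n b)"
  then have ki: "k < Suc n" "i < Suc n" by (auto simp: offset_mat_def)
  have "((L_mat n - 1\<^sub>m (Suc n)) * (Dh n b * L_mat n)) $$ (k, i) =
      (\<Sum>m<Suc n. (L_mat n - 1\<^sub>m (Suc n)) $$ (k, m) * (Dh n b * L_mat n) $$ (m, i))"
    using ki by (intro index_mult_mat_sum)
      (auto intro: mult_carrier_mat[of _ "Suc n" "Suc n"] minus_carrier_mat)
  also have "\<dots> = (\<Sum>m<Suc n. if i \<le> m \<and> m < k then b (Suc m) - b m else 0)"
    using ki unfolding Dh_def
    by (subst mat_diag_mult_left[where nr = "Suc n"])
      (auto simp: L_mat_def mesh_size_def intro!: sum.cong simp del: sum.lessThan_Suc)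
  also have "\<dots> = (\<Sum>m\<in>{i..<k}. b (Suc m) - b m)"
    using ki by (intro sum.mono_neutral_cong_right) auto
  also have "\<dots> = offset_mat n b $$ (k, i)"
    using ki by (auto simp: offset_mat_def sum_Suc_diff')
  finally show "((L_mat n - 1\<^sub>m (Suc n)) * (Dh n b * L_mat n)) $$ (k, i) = offset_mat n b $$ (k, i)" .
qed (auto simp: offset_mat_def Dh_def L_mat_def)

section \<open>Lebesgue integration on open subintervals\<close>

lemma LINT_open_interval_split:
  fixes f :: "real \<Rightarrow> real" and b :: "nat \<Rightarrow> real"
  assumes "\<And>i. i < m \<Longrightarrow> b i < b (Suc i)"
    and "integrable (lebesgue_on {b 0<..<b m}) f"
  shows "(LINT x|lebesgue_on {b 0<..<b m}. f x) = (\<Sum>k<m. LINT x|lebesgue_on {b k<..<b (Suc k)}. f x)"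
  using assms
proof (induction m)
  case 0
  then show ?case by (simp add: lebesgue_integral_eq_integral)
next
  case (Suc m)
  have "b 0 \<le> b k" if "k \<le> m" for k
    using that
  proof (induction k)
    case (Suc k)
    then show ?case using Suc.prems(1) \<open>\<And>i. i < Suc m \<Longrightarrow> b i < b (Suc i)\<close>[of k] by simp
  qed simp
  then have le: "b 0 \<le> b m" "b m \<le> b (Suc m)"
    using Suc.prems(1) by (auto simp: less_imp_le)
  have sub: "integrable (lebesgue_on T) f" if "T \<subseteq> {b 0<..<b (Suc m)}" "T \<in> sets lebesgue" for T
    using Suc.prems(2) that set_integrable_subset[of lebesgue "{b 0<..<b (Suc m)}" f T]
    by (simp add: integrable_restrict_space set_integrable_def)
  \<comment> \<open>The open pieces omit the breakpoints. Passing to gauge integrals over closed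
    intervals makes these endpoints harmless and allows adjacent pieces to be combined.\<close>
  have eq: "(LINT x|lebesgue_on {c<..<d}. f x) = integral {c..d} f"
    if "b 0 \<le> c" "d \<le> b (Suc m)" for c d
  proof -
    have "{c<..<d} \<subseteq> {b 0<..<b (Suc m)}" using that by auto
    then show ?thesis
      using sub[of "{c<..<d}"] by (simp add: lebesgue_integral_eq_integral integral_open_interval_real)
  qed
  have "f integrable_on {b 0..b (Suc m)}"
    using integrable_on_lebesgue_on[OF Suc.prems(2)] by (simp add: integrable_on_open_interval_real)
  then have "integral {b 0..b (Suc m)} f = integral {b 0..b m} f + integral {b m..b (Suc m)} f"
    using le by (simp add: Henstock_Kurzweil_Integration.integral_combine)
  moreover have "(LINT x|lebesgue_on {b 0<..<b m}. f x) = (\<Sum>k<m. LINT x|lebesgue_on {b k<..<b (Suc k)}. f x)"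
    using Suc.prems(1) le by (intro Suc.IH sub) auto
  ultimately show ?case using le by (simp add: eq)
qed

text \<open>An essentially bounded weight times a bounded Borel function is essentially bounded,
  hence integrable on a space of finite measure.\<close>

lemma Linfty_mult_integrable:
  assumes "w \<in> Linfty unit_interval" "f \<in> borel_measurable borel"
    and "\<And>x. x \<in> unit_interval \<Longrightarrow> \<bar>f x\<bar> \<le> C"
  shows "integrable (lebesgue_on unit_interval) (\<lambda>x. w x * f x)"
proof -
  obtain K where w: "w \<in> borel_measurable (lebesgue_on unit_interval)"
    and K: "AE x in lebesgue_on unit_interval. \<bar>w x\<bar> \<le> K"
    using assms(1) by (auto simp: Linfty_def)
  interpret finite_measure "lebesgue_on unit_interval"
    by (rule finite_measure_lebesgue_on) simp
  have "f \<in> borel_measurable (lebesgue_on unit_interval)"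
    using assms(2) by (intro measurable_restrict_space1 measurable_completion) simp
  then show ?thesis
  proof (intro integrable_const_bound[where B = "K * C"] borel_measurable_times w)
    \<comment> \<open>The bound \<open>K\<close> on \<open>w\<close> holds only almost everywhere,
      whereas \<open>C\<close> bounds \<open>f\<close> at every point of the interval;
      \<open>AE_space\<close> supplies membership in it.\<close>
    show "AE x in lebesgue_on unit_interval. norm (w x * f x) \<le> K * C"
      using K AE_space
    proof eventually_elim
      case (elim x)
      then show ?case using assms(3)[of x] by (auto simp: abs_mult intro!: mult_mono)
    qed
  qed
qed

text \<open>Needed to split the integral of a polynomial in x - c, times the weight, into separate
  moments.\<close>

lemma local_moment_integrable:
  assumes "w \<in> Linfty unit_interval" "0 \<le> c" "c \<le> d" "d \<le> 1"
  shows "integrable (lebesgue_on {c<..<d}) (\<lambda>x. w x * (x - c) ^ k)"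
proof -
  have "integrable (lebesgue_on unit_interval) (\<lambda>x. w x * (x - c) ^ k)"
  proof (rule Linfty_mult_integrable[OF assms(1)])
    fix x :: real assume "x \<in> unit_interval"
    then have "\<bar>x - c\<bar> \<le> 1" using assms by auto
    then show "\<bar>(x - c) ^ k\<bar> \<le> 1" by (simp add: power_abs power_le_one)
  qed measurable
  moreover have "{c<..<d} \<subseteq> unit_interval" using assms by auto
  ultimately show ?thesis
    using set_integrable_subset[of lebesgue unit_interval "\<lambda>x. w x * (x - c) ^ k" "{c<..<d}"]
    by (simp add: integrable_restrict_space set_integrable_def)
qed

section \<open>The mesh and the elementwise assembly of both matrices\<close>

locale mesh =
  fixes n :: nat and b :: "nat \<Rightarrow> real"
  assumes b_first: "b 0 = 0" and b_last: "b (Suc n) = 1"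
    and b_step: "\<And>i. i \<le> n \<Longrightarrow> b i < b (i + 1)"
begin

lemma b_mono: "i \<le> j \<Longrightarrow> j \<le> Suc n \<Longrightarrow> b i \<le> b j"
proof (induction j rule: dec_induct)
  case (step m)
  then show ?case using b_step[of m] by simp
qed simp

lemma b_bounds: "i \<le> Suc n \<Longrightarrow> 0 \<le> b i \<and> b i \<le> 1"
  using b_mono[of 0 i] b_mono[of i "Suc n"] b_first b_last by auto

lemma mesh_size_nonzero: "i < Suc n \<Longrightarrow> mesh_size b i \<noteq> 0"
  using b_step[of i] by (simp add: mesh_size_def)

lemma LINT_mesh_split:
  fixes f :: "real \<Rightarrow> real"
  assumes "integrable (lebesgue_on unit_interval) f"
  shows "(LINT x|lebesgue_on unit_interval. f x) =
    (\<Sum>k<Suc n. LINT x|lebesgue_on {b k<..<b (k + 1)}. f x)"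
  using LINT_open_interval_split[of "Suc n" b f] assms b_first b_last b_step by simp

text \<open>No breakpoint lies inside an open element, so the kink at \<open>b i\<close> is either
  at or before its left endpoint or at or after its right one, and the function is affine
  there.\<close>

lemma relu_on_element:
  assumes "k < Suc n" "i < Suc n" "x \<in> {b k<..<b (k + 1)}"
  shows "relu (x - b i) = offset_mat n b $$ (k, i) + (x - b k) * L_mat n $$ (k, i)"
proof (cases "i \<le> k")
  case True
  then show ?thesis using assms b_mono[of i k] by (simp add: relu_def offset_mat_def L_mat_def)
next
  case False
  then show ?thesis
    using assms b_mono[of "k + 1" i] by (simp add: relu_def offset_mat_def L_mat_def)
qed

text \<open>The open element never meets x = \<open>b i\<close>, so the value 1/2 of the Heaviside
  function does not occur.\<close>

lemma heaviside_on_element: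
  assumes "k < Suc n" "i < Suc n" "x \<in> {b k<..<b (k + 1)}"
  shows "heaviside (x - b i) = L_mat n $$ (k, i)"
proof (cases "i \<le> k")
  case True
  then show ?thesis using assms b_mono[of i k] by (simp add: heaviside_def L_mat_def)
next
  case False
  then show ?thesis using assms b_mono[of "k + 1" i] by (simp add: heaviside_def L_mat_def)
qed

lemma stiffness_matrix_index:
  assumes "a \<in> Linfty unit_interval" "i < Suc n" "j < Suc n"
  shows "stiffness_matrix n a b $$ (i, j) =
    (\<Sum>k<Suc n. L_mat n $$ (k, i) * local_moment a b 0 k * L_mat n $$ (k, j))"
proof -
  have "integrable (lebesgue_on unit_interval)
      (\<lambda>x. a x * (heaviside (x - b i) * heaviside (x - b j)))"
    by (rule Linfty_mult_integrable[OF assms(1), where C = 1])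
      (auto simp: heaviside_def[abs_def])
  then have "stiffness_matrix n a b $$ (i, j) = (\<Sum>k<Suc n. LINT x|lebesgue_on {b k<..<b (k + 1)}.
      a x * (heaviside (x - b i) * heaviside (x - b j)))"
    using assms by (simp add: stiffness_matrix_def LINT_mesh_split mult.assoc del: sum.lessThan_Suc)
  \<comment> \<open>The factor \<open>(x - b k) ^ 0\<close> is inserted to match the zeroth local
    moment.\<close>
  also have "\<dots> = (\<Sum>k<Suc n. LINT x|lebesgue_on {b k<..<b (k + 1)}.
      L_mat n $$ (k, i) * L_mat n $$ (k, j) * (a x * (x - b k) ^ 0))"
    using assms by (intro sum.cong refl Bochner_Integration.integral_cong)
      (auto simp: heaviside_on_element space_restrict_space)
  finally show ?thesis by (simp add: local_moment_def mult_ac del: sum.lessThan_Suc)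
qed

lemma mass_matrix_index:
  assumes r: "r \<in> Linfty unit_interval" and ij: "i < Suc n" "j < Suc n"
  shows "mass_matrix n r b $$ (i, j) =
    (\<Sum>k<Suc n. offset_mat n b $$ (k, i) * local_moment r b 0 k * offset_mat n b $$ (k, j)
      + offset_mat n b $$ (k, i) * local_moment r b 1 k * L_mat n $$ (k, j)
      + L_mat n $$ (k, i) * local_moment r b 1 k * offset_mat n b $$ (k, j)
      + L_mat n $$ (k, i) * local_moment r b 2 k * L_mat n $$ (k, j))"
proof -
  \<comment> \<open>Breakpoints and integration points both lie in [0, 1], which gives the bound 1
    required for integrability.\<close>
  have relu_bound: "0 \<le> relu (x - b m) \<and> relu (x - b m) \<le> 1"
    if "x \<in> unit_interval" "m < Suc n" for x m
    using that b_bounds[of m] by (auto simp: relu_def)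
  have "\<bar>relu (x - b i) * relu (x - b j)\<bar> \<le> 1" if "x \<in> unit_interval" for x
    using relu_bound[OF that ij(1)] relu_bound[OF that ij(2)] by (simp add: abs_mult mult_le_one)
  then have "integrable (lebesgue_on unit_interval)
      (\<lambda>x. r x * (relu (x - b i) * relu (x - b j)))"
    by (intro Linfty_mult_integrable[OF r, where C = 1]) (auto simp: relu_def[abs_def])
  then have "mass_matrix n r b $$ (i, j) = (\<Sum>k<Suc n. LINT x|lebesgue_on {b k<..<b (k + 1)}.
      r x * (relu (x - b i) * relu (x - b j)))"
    using ij by (simp add: mass_matrix_def LINT_mesh_split mult.assoc del: sum.lessThan_Suc)
  also have "\<dots> = (\<Sum>k<Suc n. offset_mat n b $$ (k, i) * local_moment r b 0 k * offset_mat n b $$ (k, j)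
      + offset_mat n b $$ (k, i) * local_moment r b 1 k * L_mat n $$ (k, j)
      + L_mat n $$ (k, i) * local_moment r b 1 k * offset_mat n b $$ (k, j)
      + L_mat n $$ (k, i) * local_moment r b 2 k * L_mat n $$ (k, j))"
  proof (rule sum.cong[OF refl])
    fix k assume "k \<in> {..<Suc n}"
    then have k: "k < Suc n" by simp
    \<comment> \<open>These entries do not depend on \<open>x\<close>, so the integrand is the
      weight times a quadratic polynomial in \<open>x - b k\<close>; the two mixed products share
      the first moment.\<close>
    define Bi Bj Li Lj where "Bi = offset_mat n b $$ (k, i)" and "Bj = offset_mat n b $$ (k, j)"
      and "Li = L_mat n $$ (k, i)" and "Lj = L_mat n $$ (k, j)"
    have int: "integrable (lebesgue_on {b k<..<b (k + 1)}) (\<lambda>x. r x * (x - b k) ^ p)" for p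
      using b_bounds[of k] b_bounds[of "k + 1"] b_step[of k] k
      by (intro local_moment_integrable r) auto
    have "(LINT x|lebesgue_on {b k<..<b (k + 1)}. r x * (relu (x - b i) * relu (x - b j))) =
        (LINT x|lebesgue_on {b k<..<b (k + 1)}. Bi * Bj * (r x * (x - b k) ^ 0)
          + (Bi * Lj + Li * Bj) * (r x * (x - b k) ^ 1) + Li * Lj * (r x * (x - b k) ^ 2))"
    proof (intro Bochner_Integration.integral_cong refl)
      fix x assume "x \<in> space (lebesgue_on {b k<..<b (k + 1)})"
      then have x: "x \<in> {b k<..<b (k + 1)}" by (simp add: space_restrict_space)
      show "r x * (relu (x - b i) * relu (x - b j)) = Bi * Bj * (r x * (x - b k) ^ 0)
          + (Bi * Lj + Li * Bj) * (r x * (x - b k) ^ 1) + Li * Lj * (r x * (x - b k) ^ 2)"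
        unfolding relu_on_element[OF k ij(1) x] relu_on_element[OF k ij(2) x]
          Bi_def[symmetric] Bj_def[symmetric] Li_def[symmetric] Lj_def[symmetric]
        by (simp add: power2_eq_square algebra_simps)
    qed
    also have "\<dots> = Bi * Bj * local_moment r b 0 k
        + (Bi * Lj + Li * Bj) * local_moment r b 1 k + Li * Lj * local_moment r b 2 k"
      unfolding local_moment_def by (simp only: Bochner_Integration.integral_add integral_mult_right_zero
          Bochner_Integration.integrable_add integrable_mult_right int)
    finally show "(LINT x|lebesgue_on {b k<..<b (k + 1)}. r x * (relu (x - b i) * relu (x - b j))) =
      offset_mat n b $$ (k, i) * local_moment r b 0 k * offset_mat n b $$ (k, j)
      + offset_mat n b $$ (k, i) * local_moment r b 1 k * L_mat n $$ (k, j)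
      + L_mat n $$ (k, i) * local_moment r b 1 k * offset_mat n b $$ (k, j)
      + L_mat n $$ (k, i) * local_moment r b 2 k * L_mat n $$ (k, j)"
      by (simp add: Bi_def Bj_def Li_def Lj_def algebra_simps)
  qed
  finally show ?thesis .
qed

section \<open>The inverse of Q\<close>

lemma minv_Dh: "minv (Dh n b) = mat_diag (Suc n) (\<lambda>i. inverse (mesh_size b i))"
  using minv_mat_diag[OF mesh_size_nonzero] by (simp add: Dh_def)

lemma minv_Dh_mult_Dh: "minv (Dh n b) * Dh n b = 1\<^sub>m (Suc n)"
  unfolding minv_Dh using mesh_size_nonzero by (simp add: Dh_def mat_diag_eq_one)

lemma minv_Dh_carrier [simp]: "minv (Dh n b) \<in> carrier_mat (Suc n) (Suc n)"
  by (simp add: minv_Dh)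

text \<open>Entry (k, i) works out as \<open>b (k + 1) - b i\<close> for i \<le> k and 0 otherwise,
  the value of sigma(x - b_i) at the right endpoint of element \<open>k\<close>. The bracketing lets
  \<open>G_mat n\<close> cancel the leading \<open>L_mat n\<close>.\<close>

definition R_mat :: "real mat" where
  "R_mat = L_mat n * (Dh n b * L_mat n)"

lemma R_mat_carrier [simp]: "R_mat \<in> carrier_mat (Suc n) (Suc n)"
  unfolding R_mat_def by (intro mult_carrier_mat[of _ "Suc n" "Suc n"]) simp_all

lemma Q_mat_carrier [simp]: "Q_mat n b \<in> carrier_mat (Suc n) (Suc n)"
  unfolding Q_mat_def by (intro mult_carrier_mat[of _ "Suc n" "Suc n"]) simp_all

text \<open>Differences of consecutive endpoint values are mesh size times slope on each
  element.\<close>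

lemma G_mat_mult_R_mat: "G_mat n * R_mat = Dh n b * L_mat n"
proof -
  have "G_mat n * R_mat = (G_mat n * L_mat n) * (Dh n b * L_mat n)"
    unfolding R_mat_def
    by (rule assoc_mult_mat[symmetric, of _ "Suc n" "Suc n" _ "Suc n" _ "Suc n"])
      (auto intro!: mult_carrier_mat[of _ "Suc n" "Suc n"])
  then show ?thesis
    by (simp add: G_mat_mult_L_mat left_mult_one_mat[OF mult_carrier_mat[OF Dh_carrier L_mat_carrier]])
qed

text \<open>\<open>I - G\<close> shifts rows down by one, turning right-endpoint values into
  left-endpoint values. Algebraically, \<open>R - G * R\<close> is
  \<open>L * (D * L) - D * L\<close>, where \<open>D\<close> stands for
  \<open>Dh n b\<close>.\<close>

lemma one_minus_G_mat_mult_R_mat: "(1\<^sub>m (Suc n) - G_mat n) * R_mat = offset_mat n b"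
proof -
  have DL: "Dh n b * L_mat n \<in> carrier_mat (Suc n) (Suc n)"
    by (intro mult_carrier_mat[of _ "Suc n" "Suc n"]) simp_all
  have "(1\<^sub>m (Suc n) - G_mat n) * R_mat = R_mat - Dh n b * L_mat n"
    by (simp add: minus_mult_distrib_mat[of _ "Suc n" "Suc n" _ _ "Suc n"] G_mat_mult_R_mat
        left_mult_one_mat[of _ "Suc n" "Suc n"] del: One_nat_def Suc_eq_plus1 add_Suc_right)
  also have "\<dots> = (L_mat n - 1\<^sub>m (Suc n)) * (Dh n b * L_mat n)"
    unfolding R_mat_def using DL
    by (simp add: minus_mult_distrib_mat[of _ "Suc n" "Suc n" _ _ "Suc n"]
        left_mult_one_mat[of _ "Suc n" "Suc n"])
  finally show ?thesis by (simp only: L_mat_minus_one_mult_Dh_mult_L_mat)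
qed

lemma Q_mat_mult_R_mat: "Q_mat n b * R_mat = 1\<^sub>m (Suc n)"
proof -
  have "Q_mat n b * R_mat = G_mat n * (minv (Dh n b) * (G_mat n * R_mat))"
    unfolding Q_mat_def
    by (simp add: assoc_mult_mat[of _ "Suc n" "Suc n" _ "Suc n" _ "Suc n"] mult_carrier_mat[of _ "Suc n" "Suc n"])
  also have "\<dots> = G_mat n * ((minv (Dh n b) * Dh n b) * L_mat n)"
    unfolding G_mat_mult_R_mat
    by (simp add: assoc_mult_mat[of _ "Suc n" "Suc n" _ "Suc n" _ "Suc n"])
  also have "\<dots> = 1\<^sub>m (Suc n)"
    by (simp only: minv_Dh_mult_Dh left_mult_one_mat[OF L_mat_carrier] G_mat_mult_L_mat)
  finally show ?thesis .
qed

text \<open>For square matrices over a field a one-sided inverse is two-sided.\<close>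

lemma R_mat_mult_Q_mat: "R_mat * Q_mat n b = 1\<^sub>m (Suc n)"
  by (rule mat_mult_left_right_inverse[OF _ _ Q_mat_mult_R_mat]) simp_all

section \<open>The tridiagonal factors in congruence form\<close>

lemma transpose_one_minus_G:
  "1\<^sub>m (Suc n) - transpose_mat (G_mat n) = transpose_mat (1\<^sub>m (Suc n) - G_mat n)"
  by (subst transpose_minus[of _ "Suc n" "Suc n"]) simp_all

text \<open>Merging the diagonal factors brings the matrix into the form X^T D Y, to which the entry
  formula, the congruence rule and the tridiagonality criterion apply.\<close>

lemma T_stiff_eq:
  "T_stiff n a b = transpose_mat (G_mat n) *
    mat_diag (Suc n) (\<lambda>k. local_moment a b 0 k / (mesh_size b k)\<^sup>2) * G_mat n"
  unfolding T_stiff_def minv_Dh Ds_def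
  by (simp add: numeral_2_eq_2 mat_diag_diag assoc_mult_mat[of _ "Suc n" "Suc n" _ "Suc n" _ "Suc n"]
      power2_eq_square divide_inverse mult_ac)

text \<open>The same normal form for all four terms, with outer factors \<open>I - G\<close> and
  \<open>G\<close>, both lower bidiagonal.\<close>

lemma T_mass_eq:
  "T_mass n r b =
    transpose_mat (1\<^sub>m (Suc n) - G_mat n) * mat_diag (Suc n) (local_moment r b 0) * (1\<^sub>m (Suc n) - G_mat n)
    + transpose_mat (1\<^sub>m (Suc n) - G_mat n) * mat_diag (Suc n) (\<lambda>k. local_moment r b 1 k / mesh_size b k) * G_mat n
    + transpose_mat (G_mat n) * mat_diag (Suc n) (\<lambda>k. local_moment r b 1 k / mesh_size b k) * (1\<^sub>m (Suc n) - G_mat n)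
    + transpose_mat (G_mat n) * mat_diag (Suc n) (\<lambda>k. local_moment r b 2 k / (mesh_size b k)\<^sup>2) * G_mat n"
  unfolding T_mass_def Let_def D00_def D01_def D10_def D11_def minv_Dh Ds_def
  by (simp add: transpose_one_minus_G numeral_2_eq_2 power2_eq_square divide_inverse mult_ac)

lemma T_stiff_carrier [simp]: "T_stiff n a b \<in> carrier_mat (Suc n) (Suc n)"
  unfolding T_stiff_eq by (auto intro!: mult_carrier_mat[of _ "Suc n" "Suc n"])

lemma T_mass_carrier [simp]: "T_mass n r b \<in> carrier_mat (Suc n) (Suc n)"
  unfolding T_mass_eq
  by (auto intro!: add_carrier_mat mult_carrier_mat[of _ "Suc n" "Suc n"] minus_carrier_mat)

lemma tridiagonal_T_stiff: "tridiagonal_mat (T_stiff n a b)"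
  unfolding T_stiff_eq by (rule tridiagonal_mat_transpose_diag_mult) (auto simp: G_mat_def)

lemma tridiagonal_T_mass: "tridiagonal_mat (T_mass n r b)"
  unfolding T_mass_eq
  by (intro tridiagonal_mat_add[where N = "Suc n"] tridiagonal_mat_transpose_diag_mult)
    (auto simp: G_mat_def intro!: add_carrier_mat mult_carrier_mat[of _ "Suc n" "Suc n"] minus_carrier_mat)

section \<open>Factorization of the stiffness and mass matrices\<close>

lemma Dh_mult_L_mat_index:
  "k < Suc n \<Longrightarrow> i < Suc n \<Longrightarrow> (Dh n b * L_mat n) $$ (k, i) = mesh_size b k * L_mat n $$ (k, i)"
  by (simp add: Dh_def mat_diag_mult_left[OF L_mat_carrier])

lemma stiffness_matrix_factorization:
  assumes "a \<in> Linfty unit_interval"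
  shows "stiffness_matrix n a b = transpose_mat R_mat * T_stiff n a b * R_mat"
proof -
  have DL: "Dh n b * L_mat n \<in> carrier_mat (Suc n) (Suc n)"
    by (rule mult_carrier_mat[of _ "Suc n" "Suc n"]) simp_all
  have "transpose_mat R_mat * T_stiff n a b * R_mat = transpose_mat (Dh n b * L_mat n) *
      mat_diag (Suc n) (\<lambda>k. local_moment a b 0 k / (mesh_size b k)\<^sup>2) * (Dh n b * L_mat n)"
    unfolding T_stiff_eq
    by (subst congruence_transpose_diag_mult[of _ "Suc n"]) (simp_all add: G_mat_mult_R_mat)
  also have "\<dots> = stiffness_matrix n a b"
  proof (rule eq_matI)
    fix i j assume "i < dim_row (stiffness_matrix n a b)" "j < dim_col (stiffness_matrix n a b)"
    then have ij: "i < Suc n" "j < Suc n" by (auto simp: stiffness_matrix_def)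
    \<comment> \<open>Each outer factor contributes one \<open>mesh_size b k\<close>, and together
      they cancel the squared denominator.\<close>
    show "(transpose_mat (Dh n b * L_mat n) *
      mat_diag (Suc n) (\<lambda>k. local_moment a b 0 k / (mesh_size b k)\<^sup>2) * (Dh n b * L_mat n)) $$ (i, j)
      = stiffness_matrix n a b $$ (i, j)"
      unfolding index_transpose_diag_mult[OF DL DL ij] stiffness_matrix_index[OF assms ij]
      using ij mesh_size_nonzero
      by (intro sum.cong refl) (simp add: Dh_mult_L_mat_index power2_eq_square)
  qed (use DL in \<open>auto simp: stiffness_matrix_def\<close>)
  finally show ?thesis ..
qed

lemma mass_matrix_factorization:
  assumes "r \<in> Linfty unit_interval"
  shows "mass_matrix n r b = transpose_mat R_mat * T_mass n r b * R_mat"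
proof -
  let ?N = "Suc n"
  let ?DL = "Dh n b * L_mat n" and ?P = "1\<^sub>m ?N - G_mat n" and ?B = "offset_mat n b"
  let ?E0 = "mat_diag ?N (local_moment r b 0)"
    and ?E1 = "mat_diag ?N (\<lambda>k. local_moment r b 1 k / mesh_size b k)"
    and ?E2 = "mat_diag ?N (\<lambda>k. local_moment r b 2 k / (mesh_size b k)\<^sup>2)"
  have DL: "?DL \<in> carrier_mat ?N ?N" by (rule mult_carrier_mat[of _ ?N ?N]) simp_all
  have P: "?P \<in> carrier_mat ?N ?N" by (simp add: minus_carrier_mat)
  have carrier: "transpose_mat X * mat_diag ?N d * Y \<in> carrier_mat ?N ?N"
    if "X \<in> carrier_mat ?N ?N" "Y \<in> carrier_mat ?N ?N" for X Y :: "real mat" and d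
    using that by (auto intro!: mult_carrier_mat[of _ ?N ?N])
  note carriers = carrier[OF P P] carrier[OF P G_mat_carrier] carrier[OF G_mat_carrier P]
    carrier[OF G_mat_carrier G_mat_carrier]
  note B = offset_mat_carrier[of n b]
  have "transpose_mat R_mat * T_mass n r b * R_mat =
      transpose_mat ?B * ?E0 * ?B + transpose_mat ?B * ?E1 * ?DL
      + transpose_mat ?DL * ?E1 * ?B + transpose_mat ?DL * ?E2 * ?DL"
    unfolding T_mass_eq
    using P carriers
    \<comment> \<open>The congruence distributes over the four terms; then each \<open>G * R\<close>
      becomes \<open>?DL\<close> and each \<open>(I - G) * R\<close> becomes
      \<open>?B\<close>.\<close>
    by (simp only: congruence_add[of _ ?N] congruence_transpose_diag_mult[of _ ?N]
        add_carrier_mat R_mat_carrier G_mat_carrier mat_diag_dim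
        G_mat_mult_R_mat one_minus_G_mat_mult_R_mat)
  also have "\<dots> = mass_matrix n r b"
  proof (rule eq_matI)
    fix i j assume "i < dim_row (mass_matrix n r b)" "j < dim_col (mass_matrix n r b)"
    then have ij: "i < ?N" "j < ?N" by (auto simp: mass_matrix_def)
    have "(transpose_mat ?B * ?E0 * ?B + transpose_mat ?B * ?E1 * ?DL
      + transpose_mat ?DL * ?E1 * ?B + transpose_mat ?DL * ?E2 * ?DL) $$ (i, j) =
      (transpose_mat ?B * ?E0 * ?B) $$ (i, j) + (transpose_mat ?B * ?E1 * ?DL) $$ (i, j)
      + (transpose_mat ?DL * ?E1 * ?B) $$ (i, j) + (transpose_mat ?DL * ?E2 * ?DL) $$ (i, j)"
      using ij by (simp del: index_mult_mat(1)
          add: carrier_matD[OF B] carrier_matD[OF DL] carrier_matD[OF L_mat_carrier])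
    \<comment> \<open>The power of the mesh size in each denominator equals the number of outer
      factors \<open>?DL\<close> in that term, so all mesh sizes cancel.\<close>
    also have "\<dots> = mass_matrix n r b $$ (i, j)"
      unfolding index_transpose_diag_mult[OF B B ij] index_transpose_diag_mult[OF B DL ij]
        index_transpose_diag_mult[OF DL B ij] index_transpose_diag_mult[OF DL DL ij]
        mass_matrix_index[OF assms ij] sum.distrib[symmetric]
      using ij mesh_size_nonzero
      by (intro sum.cong refl) (simp add: Dh_mult_L_mat_index power2_eq_square)
    finally show "(transpose_mat ?B * ?E0 * ?B + transpose_mat ?B * ?E1 * ?DL
      + transpose_mat ?DL * ?E1 * ?B + transpose_mat ?DL * ?E2 * ?DL) $$ (i, j)
      = mass_matrix n r b $$ (i, j)" .
  qed (use DL in \<open>auto simp: mass_matrix_def\<close>)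
  finally show ?thesis ..
qed

section \<open>Inverses in the notation of the theorem\<close>

lemma minv_Q_mat: "minv (Q_mat n b) = R_mat"
  by (rule minv_eq[of _ "Suc n"]) (simp_all add: Q_mat_mult_R_mat R_mat_mult_Q_mat)

lemma transpose_Q_mat_inverse:
  "transpose_mat (Q_mat n b) * transpose_mat R_mat = 1\<^sub>m (Suc n)"
  "transpose_mat R_mat * transpose_mat (Q_mat n b) = 1\<^sub>m (Suc n)"
  by (simp_all add: transpose_mult[of _ "Suc n" "Suc n" _ "Suc n", symmetric]
      Q_mat_mult_R_mat R_mat_mult_Q_mat)

text \<open>Inverting the transpose and transposing the inverse give the same matrix, so the two
  displayed factorizations coincide.\<close>

lemma minv_transpose_Q_mat: "minv (transpose_mat (Q_mat n b)) = transpose_mat R_mat"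
  by (rule minv_eq[of _ "Suc n"]) (simp_all add: transpose_Q_mat_inverse)

end

theorem mainTheorem3:
  fixes n :: nat and b :: "nat \<Rightarrow> real" and a r :: "real \<Rightarrow> real" and a0 r0 :: real
    and Q T1 T3 T4 :: "real mat"
  assumes "n \<ge> 1"
    and "b 0 = 0" and "b (n + 1) = 1" and "\<And>i. i \<le> n \<Longrightarrow> b i < b (i + 1)"
    and "a \<in> Linfty unit_interval" and "r \<in> Linfty unit_interval"
    and "a0 > 0" and "AE x in lebesgue_on unit_interval. a x \<ge> a0"
    and "r0 \<ge> 0" and "AE x in lebesgue_on unit_interval. r x \<ge> r0"
    and "Q = Q_mat n b" and "T1 = transpose_mat Q" and "T3 = Q"
    and "T4 = T_stiff n a b + T_mass n r b"
  shows "invertible_mat Q \<and> invertible_mat T1 \<and> invertible_mat T3 \<and> tridiagonal_mat T4 \<and>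
    stiffness_matrix n a b + mass_matrix n r b = minv T1 * T4 * minv T3 \<and>
    stiffness_matrix n a b + mass_matrix n r b =
      transpose_mat (minv Q) * (T_stiff n a b + T_mass n r b) * minv Q"
proof -
  interpret mesh n b using assms(2-4) by unfold_locales auto
  \<comment> \<open>Both factorizations use the same congruence by \<open>R_mat\<close>, so they
    add.\<close>
  have fact: "stiffness_matrix n a b + mass_matrix n r b =
      transpose_mat R_mat * (T_stiff n a b + T_mass n r b) * R_mat"
    by (simp add: stiffness_matrix_factorization mass_matrix_factorization assms(5,6)
        congruence_add[of _ "Suc n"])
  have "invertible_mat (Q_mat n b)" "invertible_mat (transpose_mat (Q_mat n b))"
    by (rule invertible_matI[OF _ _ Q_mat_mult_R_mat R_mat_mult_Q_mat]; simp)
      (rule invertible_matI[OF _ _ transpose_Q_mat_inverse]; simp)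
  moreover have "tridiagonal_mat (T_stiff n a b + T_mass n r b)"
    by (rule tridiagonal_mat_add[OF tridiagonal_T_stiff tridiagonal_T_mass T_stiff_carrier T_mass_carrier])
  ultimately show ?thesis
    using fact assms(11-14) by (simp add: minv_Q_mat minv_transpose_Q_mat)
qed

end
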